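(* Let $T=S\Lambda S^{-1}$ be the recursion matrix of the system $(w_1,w_2,\mathrm d\mu)$, which is tetradiagonal, written in terms of its diagonals as $T=\Lambda+b+\Lambda^\top c+(\Lambda^\top)^2d$ with $b,c,d$ diagonal matrices. Let $\tilde T=\tilde S\Lambda\tilde S^{-1}$ with diagonal expansion $\tilde T=\Lambda+\tilde T^{[0]}+\Lambda^\top\tilde T^{[1]}+(\Lambda^\top)^2\tilde T^{[2]}+\cdots$, where the $\tilde T^{[k]}$ are diagonal matrices. Then, from the relation $T^\top=\hat T^2$ with $\hat T=H^{-1}\tilde TH$, one gets $$d=H(\mathfrak a_-^2H)^{-1},\qquad c=H(\mathfrak a_-H)^{-1}\big(\mathfrak a_-\tilde T^{[0]}+\tilde T^{[0]}\big),\qquad b=\tilde T^{[1]}+\mathfrak a_+\tilde T^{[1]}+(\tilde T^{[0]})^2,$$ $$(\mathfrak a_-H)H^{-1}=\tilde T^{[2]}+\mathfrak a_+\tilde T^{[2]}+\big(\mathfrak a_-\tilde T^{[0]}+\tilde T^{[0]}\big)\tilde T^{[1]},$$ as well as $$\tilde T^{[n+1]}+\mathfrak a_+\tilde T^{[n+1]}+\sum_{k=0}^n\big(\mathfrak a_-^{\,n-k}\tilde T^{[k]}\big)\tilde T^{[n-k]}=\mathbf 0,\qquad n\in\{2,3,\dots\}.$$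
   Context: Let $\Delta\subset\mathbb R$ be an interval, $\mu$ a measure supported on $\Delta$, and $w_1,w_2$ weight functions on $\Delta$ such that all moments $\int_\Delta x^kw_a(x)\,\mathrm d\mu(x)$ exist. All vectors and matrices are semi-infinite, with rows and columns indexed by $0,1,2,\dots$. Put $X(x)=(1,x,x^2,\dots)^\top$, $X_1(x)=(1,0,x,0,x^2,0,\dots)^\top$, $X_2(x)=(0,1,0,x,0,x^2,\dots)^\top$. The moment matrix is $g=\int_\Delta X(x)\big(X_1(x)w_1(x)+X_2(x)w_2(x)\big)^\top\mathrm d\mu(x)$. Standing assumption: $g$ has a Gauss–Borel factorization $g=S^{-1}H\tilde S^{-\top}$ with $S,\tilde S$ lower unitriangular and $H=\operatorname{diag}(H_0,H_1,\dots)$, all $H_n\ne0$. $\Lambda$ is the shift matrix with ones on the first superdiagonal and zeros elsewhere. The shift operators act on diagonal matrices by $\mathfrak a_-\operatorname{diag}(d_0,d_1,\dots)=\operatorname{diag}(d_1,d_2,\dots)$ and $\mathfrak a_+\operatorname{diag}(d_0,d_1,\dots)=\operatorname{diag}(0,d_0,d_1,\dots)$.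
   Formalization: The printed formulas for d and c have inverted quotients and are false; what is proved is d = (𝔞_-^2 H)H^{-1} and c = (𝔞_- H)H^{-1}(𝔞_- T̃^{[0]} + T̃^{[0]}). *)

theory Defs
  imports
    "HOL-Analysis.Analysis"
    "HOL-Library.Function_Algebras"
    "HOL-Library.Groups_Big_Fun"
begin

text \<open>
  Semi-infinite matrices are functions of a row and a column index. Addition, finite sums and
  the zero matrix are the pointwise ones of \<^theory>\<open>HOL-Library.Function_Algebras\<close>. The pointwise
  product, unit and powers of that theory are not the matrix ones and are not used.
\<close>

type_synonym smat = "nat \<Rightarrow> nat \<Rightarrow> real"

text \<open>
  An entry of a product is a sum over all indices with a nonzero summand; \<^const>\<open>Sum_any\<close> is
  meaningful only if there are finitely many of them. This is always the case when the rows of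
  the left factor, or the columns of the right factor, have finite support. Products associate
  to the left and are read in that way.
\<close>

definition smat_mult :: "smat \<Rightarrow> smat \<Rightarrow> smat"  (infixl \<open>\<odot>\<close> 70) where
  "A \<odot> B = (\<lambda>i j. Sum_any (\<lambda>k. A i k * B k j))"

definition smat_one :: smat where
  "smat_one = (\<lambda>i j. if i = j then 1 else 0)"

primrec smat_pow :: "smat \<Rightarrow> nat \<Rightarrow> smat" where
  "smat_pow A 0 = smat_one"
| "smat_pow A (Suc n) = A \<odot> smat_pow A n"

definition smat_transpose :: "smat \<Rightarrow> smat" where
  "smat_transpose A = (\<lambda>i j. A j i)"

definition lower_triangular :: "smat \<Rightarrow> bool" where
  "lower_triangular A \<longleftrightarrow> (\<forall>i j. i < j \<longrightarrow> A i j = 0)"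

definition lower_unitriangular :: "smat \<Rightarrow> bool" where
  "lower_unitriangular A \<longleftrightarrow> lower_triangular A \<and> (\<forall>i. A i i = 1)"

definition diagonal :: "smat \<Rightarrow> bool" where
  "diagonal A \<longleftrightarrow> (\<forall>i j. i \<noteq> j \<longrightarrow> A i j = 0)"

definition diag :: "(nat \<Rightarrow> real) \<Rightarrow> smat" where
  "diag d = (\<lambda>i j. if i = j then d i else 0)"

text \<open>
  A semi-infinite matrix may have several inverses, but a lower triangular one with nonzero
  diagonal (the only kind inverted here) has exactly one lower triangular inverse.
\<close>

definition smat_inv :: "smat \<Rightarrow> smat" where
  "smat_inv A = (THE B. lower_triangular B \<and> A \<odot> B = smat_one \<and> B \<odot> A = smat_one)"

definition Lam :: smat  (\<open>\<Lambda>\<close>) where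
  "\<Lambda> = (\<lambda>i j. if j = Suc i then 1 else 0)"

text \<open>The operators \<open>\<aa>\<^sub>-\<close> and \<open>\<aa>\<^sub>+\<close>; they are meant for diagonal matrices only.\<close>

definition a_minus :: "smat \<Rightarrow> smat" where
  "a_minus D = diag (\<lambda>n. D (Suc n) (Suc n))"

definition a_plus :: "smat \<Rightarrow> smat" where
  "a_plus D = diag (\<lambda>n. case n of 0 \<Rightarrow> 0 | Suc m \<Rightarrow> D m m)"

text \<open>
  Here \<open>lower_part k A\<close> is the diagonal matrix \<open>D\<close> for which \<open>(\<Lambda>\<^sup>T)\<^sup>k D\<close> has the \<open>k\<close>-th subdiagonal
  of \<open>A\<close> and zeros elsewhere, that is, the coefficient of \<open>(\<Lambda>\<^sup>T)\<^sup>k\<close> in the expansion of \<open>A\<close>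
  along its diagonals.
\<close>

definition lower_part :: "nat \<Rightarrow> smat \<Rightarrow> smat" where
  "lower_part k A = diag (\<lambda>n. A (n + k) n)"

text \<open>
  The series \<open>D\<^sub>0 + \<Lambda>\<^sup>T D\<^sub>1 + (\<Lambda>\<^sup>T)\<^sup>2 D\<^sub>2 + \<dots>\<close> for diagonal \<open>D\<^sub>k\<close>; at most one term contributes to a
  given entry.
\<close>

definition lower_series :: "(nat \<Rightarrow> smat) \<Rightarrow> smat" where
  "lower_series D = (\<lambda>i j. Sum_any (\<lambda>k. (smat_pow (smat_transpose \<Lambda>) k \<odot> D k) i j))"

definition X_vec :: "real \<Rightarrow> nat \<Rightarrow> real" where
  "X_vec x n = x ^ n"

definition X1_vec :: "real \<Rightarrow> nat \<Rightarrow> real" where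
  "X1_vec x n = (if even n then x ^ (n div 2) else 0)"

definition X2_vec :: "real \<Rightarrow> nat \<Rightarrow> real" where
  "X2_vec x n = (if odd n then x ^ (n div 2) else 0)"

definition weight_system ::
  "real set \<Rightarrow> real measure \<Rightarrow> (real \<Rightarrow> real) \<Rightarrow> (real \<Rightarrow> real) \<Rightarrow> bool" where
  "weight_system \<Delta> \<mu> w1 w2 \<longleftrightarrow>
     is_interval \<Delta> \<and> sets \<mu> = sets borel \<and> emeasure \<mu> (- \<Delta>) = 0 \<and>
     (\<forall>k. set_integrable \<mu> \<Delta> (\<lambda>x. x ^ k * w1 x)) \<and>
     (\<forall>k. set_integrable \<mu> \<Delta> (\<lambda>x. x ^ k * w2 x))"

definition moment_matrix ::
  "real set \<Rightarrow> real measure \<Rightarrow> (real \<Rightarrow> real) \<Rightarrow> (real \<Rightarrow> real) \<Rightarrow> smat" where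
  "moment_matrix \<Delta> \<mu> w1 w2 =
     (\<lambda>i j. LINT x:\<Delta>|\<mu>. X_vec x i * (X1_vec x j * w1 x + X2_vec x j * w2 x))"

definition gauss_borel :: "smat \<Rightarrow> smat \<Rightarrow> smat \<Rightarrow> smat \<Rightarrow> bool" where
  "gauss_borel g S H St \<longleftrightarrow>
     lower_unitriangular S \<and> lower_unitriangular St \<and>
     diagonal H \<and> (\<forall>n. H n n \<noteq> 0) \<and>
     g = smat_inv S \<odot> H \<odot> smat_transpose (smat_inv St)"

end

theory Submission
  imports Defs
begin

text \<open>
  Since \<open>x X\<^sub>a(x) = (\<Lambda>\<^sup>2) X\<^sub>a(x)\<close> for \<open>a = 1, 2\<close>, the moment matrix satisfies
  \<open>\<Lambda> g = g (\<Lambda>\<^sup>T)\<^sup>2\<close>. Inserting the Gauss--Borel factorization gives \<open>T H = H (Tt\<^sup>2)\<^sup>T\<close>, that is,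
  \<open>T\<^sup>T = H\<^sup>-\<^sup>1 Tt\<^sup>2 H\<close>. Both \<open>T\<close> and \<open>Tt\<close> have ones on the first superdiagonal and zeros above it.
  Comparing the diagonals of the two sides yields all the formulas.
\<close>

section \<open>Products of semi-infinite matrices\<close>

lemma smat_mult_eq_sum:
  assumes "finite K" "\<And>k. k \<notin> K \<Longrightarrow> A i k * B k j = 0"
  shows "(A \<odot> B) i j = (\<Sum>k\<in>K. A i k * B k j)"
  unfolding smat_mult_def using assms by (intro Sum_any.expand_superset) auto

lemma smat_mult_eq_single:
  assumes "\<And>k. k \<noteq> m \<Longrightarrow> A i k * B k j = 0"
  shows "(A \<odot> B) i j = A i m * B m j"
  using smat_mult_eq_sum[of "{m}" A i B j] assms by simp

lemma smat_mult_eq_0: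
  assumes "\<And>k. A i k * B k j = 0"
  shows "(A \<odot> B) i j = 0"
  using smat_mult_eq_sum[of "{}" A i B j] assms by simp

text \<open>Products of infinite matrices do not associate in general. This condition and
  \<open>col_finite\<close> make the sums in the entries finite; each associativity law below asks
  for them on two of the three factors.\<close>

definition row_finite :: "smat \<Rightarrow> bool" where
  "row_finite A \<longleftrightarrow> (\<forall>i. finite {k. A i k \<noteq> 0})"

definition col_finite :: "smat \<Rightarrow> bool" where
  "col_finite A \<longleftrightarrow> row_finite (smat_transpose A)"

lemma transpose_transpose [simp]: "smat_transpose (smat_transpose A) = A"
  by (simp add: smat_transpose_def)

lemma transpose_mult:
  "smat_transpose (A \<odot> B) = smat_transpose B \<odot> smat_transpose A"
  by (simp add: smat_transpose_def smat_mult_def mult.commute)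

lemma row_finite_sum:
  assumes "row_finite A"
  shows "(A \<odot> B) i j = (\<Sum>k | A i k \<noteq> 0. A i k * B k j)"
  using assms by (intro smat_mult_eq_sum) (auto simp: row_finite_def)

lemma row_finite_mult:
  assumes "row_finite A" "row_finite B"
  shows "row_finite (A \<odot> B)"
  unfolding row_finite_def
proof
  fix i
  let ?K = "\<Union>m\<in>{m. A i m \<noteq> 0}. {k. B m k \<noteq> 0}"
  have "{k. (A \<odot> B) i k \<noteq> 0} \<subseteq> ?K"
  proof
    fix k assume "k \<in> {k. (A \<odot> B) i k \<noteq> 0}"
    then obtain m where "A i m * B m k \<noteq> 0"
      using smat_mult_eq_0[of A i B k] by blast
    then show "k \<in> ?K" by auto
  qed
  moreover have "finite ?K"
    using assms by (auto simp: row_finite_def)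
  ultimately show "finite {k. (A \<odot> B) i k \<noteq> 0}"
    by (rule finite_subset)
qed

lemma col_finite_mult:
  assumes "col_finite A" "col_finite B"
  shows "col_finite (A \<odot> B)"
  using assms by (simp add: col_finite_def transpose_mult row_finite_mult)

text \<open>Row \<open>i\<close> of \<open>A\<close> meets finitely many rows of \<open>B\<close>,
  each of finite support. Both bracketings are thus double sums over the same finite index sets, and
  \<open>C\<close> may be arbitrary.\<close>

lemma smat_mult_assoc_row:
  assumes "row_finite A" "row_finite B"
  shows "(A \<odot> B) \<odot> C = A \<odot> (B \<odot> C)"
proof (intro ext)
  fix i j
  let ?KA = "{m. A i m \<noteq> 0}"
  let ?K = "\<Union>m\<in>?KA. {k. B m k \<noteq> 0}"
  have fA: "finite ?KA" and fK: "finite ?K"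
    using assms by (auto simp: row_finite_def)
  have B: "(B \<odot> C) m j = (\<Sum>k\<in>?K. B m k * C k j)" if "m \<in> ?KA" for m
    using fK that by (intro smat_mult_eq_sum) auto
  have "((A \<odot> B) \<odot> C) i j = (\<Sum>k\<in>?K. (A \<odot> B) i k * C k j)"
    using fK
  proof (rule smat_mult_eq_sum)
    fix k assume k: "k \<notin> ?K"
    then have "(A \<odot> B) i k = 0"
      by (intro smat_mult_eq_0) auto
    then show "(A \<odot> B) i k * C k j = 0" by simp
  qed
  also have "\<dots> = (\<Sum>k\<in>?K. \<Sum>m\<in>?KA. A i m * B m k * C k j)"
    by (simp add: row_finite_sum[OF assms(1)] sum_distrib_right)
  also have "\<dots> = (\<Sum>m\<in>?KA. \<Sum>k\<in>?K. A i m * B m k * C k j)"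
    by (rule sum.swap)
  also have "\<dots> = (\<Sum>m\<in>?KA. A i m * (B \<odot> C) m j)"
    by (intro sum.cong refl) (simp add: B sum_distrib_left mult.assoc)
  also have "\<dots> = (A \<odot> (B \<odot> C)) i j"
    by (simp add: row_finite_sum[OF assms(1)])
  finally show "((A \<odot> B) \<odot> C) i j = (A \<odot> (B \<odot> C)) i j" .
qed

lemma smat_mult_assoc_col:
  assumes "col_finite B" "col_finite C"
  shows "(A \<odot> B) \<odot> C = A \<odot> (B \<odot> C)"
proof -
  have "smat_transpose ((A \<odot> B) \<odot> C) = smat_transpose (A \<odot> (B \<odot> C))"
    using assms by (simp add: col_finite_def transpose_mult smat_mult_assoc_row)
  then show ?thesis by (metis transpose_transpose)
qed

text \<open>A row of \<open>A\<close> and a column of \<open>C\<close> already bound both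
  summations, so the middle factor may be full. The moment matrix will stand there.\<close>

lemma smat_mult_assoc_row_col:
  assumes "row_finite A" "col_finite C"
  shows "(A \<odot> B) \<odot> C = A \<odot> (B \<odot> C)"
proof (intro ext)
  fix i j
  let ?KA = "{m. A i m \<noteq> 0}" and ?KC = "{k. C k j \<noteq> 0}"
  have fC: "finite ?KC"
    using assms(2) by (simp add: col_finite_def row_finite_def smat_transpose_def)
  have C: "(D \<odot> C) m j = (\<Sum>k\<in>?KC. D m k * C k j)" for D m
    using fC by (intro smat_mult_eq_sum) auto
  show "((A \<odot> B) \<odot> C) i j = (A \<odot> (B \<odot> C)) i j"
    by (simp add: C row_finite_sum[OF assms(1)] sum_distrib_right sum_distrib_left mult.assoc)
      (rule sum.swap)
qed

lemma smat_mult_one_left [simp]: "smat_one \<odot> A = A"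
proof (intro ext)
  fix i j show "(smat_one \<odot> A) i j = A i j"
    by (subst smat_mult_eq_single[of i]) (auto simp: smat_one_def)
qed

lemma smat_mult_one_right [simp]: "A \<odot> smat_one = A"
proof (intro ext)
  fix i j show "(A \<odot> smat_one) i j = A i j"
    by (subst smat_mult_eq_single[of j]) (auto simp: smat_one_def)
qed

lemma transpose_one [simp]: "smat_transpose smat_one = smat_one"
  by (auto simp: smat_transpose_def smat_one_def fun_eq_iff)

lemma smat_pow_2 [simp]: "smat_pow A 2 = A \<odot> A"
  by (simp add: numeral_2_eq_2)

section \<open>Diagonal and shift matrices\<close>

lemma mult_diag_apply [simp]: "(A \<odot> diag d) i j = A i j * d j"
  by (subst smat_mult_eq_single[of j]) (auto simp: diag_def)

lemma diag_mult_apply [simp]: "(diag d \<odot> A) i j = d i * A i j"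
  by (subst smat_mult_eq_single[of i]) (auto simp: diag_def)

lemma diag_mult_diag [simp]: "diag d \<odot> diag e = diag (\<lambda>n. d n * e n)"
  by (intro ext) (simp, simp add: diag_def)

lemma diag_add_diag [simp]: "diag d + diag e = diag (\<lambda>n. d n + e n)"
  by (auto simp: diag_def fun_eq_iff)

lemma diagonal_eq_diag: "diagonal D \<Longrightarrow> D = diag (\<lambda>n. D n n)"
  by (auto simp: diagonal_def diag_def fun_eq_iff)

lemma a_minus_diag [simp]: "a_minus (diag d) = diag (\<lambda>n. d (Suc n))"
  by (simp add: a_minus_def diag_def)

lemma a_minus_pow_diag [simp]: "(a_minus ^^ m) (diag d) = diag (\<lambda>n. d (n + m))"
  by (induction m) auto

lemma a_plus_diag [simp]: "a_plus (diag d) = diag (\<lambda>n. case n of 0 \<Rightarrow> 0 | Suc m \<Rightarrow> d m)"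
  by (simp add: a_plus_def diag_def cong: nat.case_cong)

lemma sum_diag: "finite K \<Longrightarrow> (\<Sum>k\<in>K. diag (d k)) = diag (\<lambda>n. \<Sum>k\<in>K. d k n)"
  by (induction rule: finite_induct) (auto simp: diag_def fun_eq_iff)

lemma Lam_mult_apply [simp]: "(\<Lambda> \<odot> A) i j = A (Suc i) j"
  by (subst smat_mult_eq_single[of "Suc i"]) (auto simp: Lam_def)

lemma mult_Lam_transpose_apply [simp]: "(A \<odot> smat_transpose \<Lambda>) i j = A i (Suc j)"
  by (subst smat_mult_eq_single[of "Suc j"]) (auto simp: Lam_def smat_transpose_def)

lemma Lam_transpose_pow:
  "smat_pow (smat_transpose \<Lambda>) k = (\<lambda>i j. if i = j + k then 1 else 0)"
proof (induction k)
  case 0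
  then show ?case by (simp add: smat_one_def)
next
  case (Suc k)
  show ?case
  proof (intro ext)
    fix i j
    show "smat_pow (smat_transpose \<Lambda>) (Suc k) i j = (if i = j + Suc k then 1 else 0)"
      unfolding smat_pow.simps Suc
      by (subst smat_mult_eq_single[of "j + k"]) (auto simp: Lam_def smat_transpose_def)
  qed
qed

lemma Lam_transpose_pow_mult_diag:
  "(smat_pow (smat_transpose \<Lambda>) k \<odot> lower_part k A) i j = (if i = j + k then A i j else 0)"
  by (simp add: lower_part_def Lam_transpose_pow)

lemma row_finite_Lam: "row_finite \<Lambda>"
  by (simp add: row_finite_def Lam_def)

lemma col_finite_Lam_transpose: "col_finite (smat_transpose \<Lambda>)"
  by (simp add: col_finite_def row_finite_Lam)

lemma row_finite_diag: "row_finite (diag d)"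
  by (simp add: row_finite_def diag_def)

lemma col_finite_diag: "col_finite (diag d)"
  by (simp add: col_finite_def row_finite_def smat_transpose_def diag_def)

section \<open>Inverses of lower triangular matrices\<close>

lemma lower_triangular_row_finite: "lower_triangular A \<Longrightarrow> row_finite A"
  unfolding row_finite_def
proof
  fix i
  assume "lower_triangular A"
  then have "{k. A i k \<noteq> 0} \<subseteq> {..i}"
    by (auto simp: lower_triangular_def simp flip: not_less)
  then show "finite {k. A i k \<noteq> 0}"
    by (rule finite_subset) simp
qed

lemma lower_triangular_mult_apply:
  assumes "lower_triangular A"
  shows "(A \<odot> B) i j = (\<Sum>k\<le>i. A i k * B k j)"
  using assms by (intro smat_mult_eq_sum) (auto simp: lower_triangular_def)

text \<open>Forward substitution: row \<open>i\<close> of the equation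
  \<open>A \<odot> B = smat_one\<close>, with \<open>A\<close> lower triangular, is solved for row
  \<open>i\<close> of \<open>B\<close> in terms of the rows above it.\<close>

function forward_inverse :: "smat \<Rightarrow> nat \<Rightarrow> nat \<Rightarrow> real" where
  "forward_inverse A i j =
     (smat_one i j - (\<Sum>k\<in>{..<i}. A i k * forward_inverse A k j)) / A i i"
  by auto
termination by (relation "Wellfounded.measure (\<lambda>(A, i, j). i)") auto

declare forward_inverse.simps [simp del]

lemma forward_inverse_eq_0: "i < j \<Longrightarrow> forward_inverse A i j = 0"
proof (induction i rule: less_induct)
  case (less i)
  then show ?case
    by (subst forward_inverse.simps) (simp add: smat_one_def)
qed

lemma forward_inverse_diagonal: "forward_inverse A i i = 1 / A i i"
  by (subst forward_inverse.simps) (simp add: forward_inverse_eq_0 smat_one_def)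

lemma mult_forward_inverse:
  assumes "lower_triangular A" "\<And>i. A i i \<noteq> 0"
  shows "A \<odot> forward_inverse A = smat_one"
proof (intro ext)
  fix i j
  have "(A \<odot> forward_inverse A) i j
      = (\<Sum>k<i. A i k * forward_inverse A k j) + A i i * forward_inverse A i j"
    by (simp add: lower_triangular_mult_apply[OF assms(1)] lessThan_Suc_atMost[symmetric])
  also have "A i i * forward_inverse A i j
      = smat_one i j - (\<Sum>k<i. A i k * forward_inverse A k j)"
    by (subst forward_inverse.simps) (simp add: assms(2))
  finally show "(A \<odot> forward_inverse A) i j = smat_one i j" by simp
qed

text \<open>Forward substitution yields a right inverse \<open>B\<close> of \<open>A\<close>, and
  applied to \<open>B\<close> a right inverse \<open>C\<close> of \<open>B\<close>. Then
  \<open>A = (A \<odot> B) \<odot> C = C\<close>, so \<open>B\<close> is a left inverse as well. The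
  same regrouping shows that every lower triangular left inverse equals \<open>B\<close>, which
  makes the description in \<open>smat_inv\<close> unique.\<close>

lemma
  assumes "lower_triangular A" "\<And>i. A i i \<noteq> 0"
  shows lower_triangular_smat_inv: "lower_triangular (smat_inv A)"
    and smat_mult_inv: "A \<odot> smat_inv A = smat_one"
    and smat_inv_mult: "smat_inv A \<odot> A = smat_one"
proof -
  let ?B = "forward_inverse A"
  let ?C = "forward_inverse ?B"
  have lB: "lower_triangular ?B"
    by (simp add: lower_triangular_def forward_inverse_eq_0)
  have AB: "A \<odot> ?B = smat_one"
    using assms by (rule mult_forward_inverse)
  have BC: "?B \<odot> ?C = smat_one"
    using lB by (rule mult_forward_inverse) (simp add: forward_inverse_diagonal assms(2))
  have "A = (A \<odot> ?B) \<odot> ?C"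
    by (simp add: smat_mult_assoc_row lower_triangular_row_finite assms(1) lB BC)
  then have BA: "?B \<odot> A = smat_one"
    using AB BC by simp
  have unique: "D = ?B" if "lower_triangular D" "D \<odot> A = smat_one" for D
  proof -
    have "D = (D \<odot> A) \<odot> ?B"
      by (simp add: smat_mult_assoc_row lower_triangular_row_finite assms(1) that(1) AB)
    then show ?thesis using that(2) by simp
  qed
  have "smat_inv A = ?B"
    unfolding smat_inv_def using lB AB BA unique by (intro the_equality) blast+
  then show "lower_triangular (smat_inv A)" "A \<odot> smat_inv A = smat_one"
    "smat_inv A \<odot> A = smat_one"
    using lB AB BA by auto
qed

lemma smat_inv_diagonal_entry:
  assumes "lower_triangular A" "\<And>i. A i i \<noteq> 0"
  shows "smat_inv A i i = 1 / A i i"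
proof -
  have "(A \<odot> smat_inv A) i i = (\<Sum>k\<le>i. if k = i then A i i * smat_inv A i i else 0)"
    unfolding lower_triangular_mult_apply[OF assms(1)]
    using lower_triangular_smat_inv[OF assms]
    by (intro sum.cong) (auto simp: lower_triangular_def)
  then have "A i i * smat_inv A i i = 1"
    by (simp add: smat_mult_inv[OF assms] smat_one_def)
  then show ?thesis using assms(2)[of i] by (simp add: eq_divide_eq mult.commute)
qed

lemma smat_inv_diag:
  assumes "\<And>n. d n \<noteq> 0"
  shows "smat_inv (diag d) = diag (\<lambda>n. 1 / d n)"
proof -
  have "lower_triangular (diag d)"
    by (simp add: lower_triangular_def diag_def)
  moreover have "diag d n n \<noteq> 0" for n
    by (simp add: diag_def assms)
  ultimately have inv: "diag d \<odot> smat_inv (diag d) = smat_one"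
    by (rule smat_mult_inv)
  show ?thesis
  proof (intro ext)
    fix i j
    have "d i * smat_inv (diag d) i j = smat_one i j"
      by (metis diag_mult_apply inv)
    then show "smat_inv (diag d) i j = diag (\<lambda>n. 1 / d n) i j"
      using assms[of i] by (auto simp: smat_one_def diag_def field_simps split: if_splits)
  qed
qed

lemma lower_unitriangular_inv:
  assumes "lower_unitriangular A"
  shows "lower_unitriangular (smat_inv A)" "A \<odot> smat_inv A = smat_one"
    "smat_inv A \<odot> A = smat_one"
proof -
  have A: "lower_triangular A" "A i i = 1" for i
    using assms by (auto simp: lower_unitriangular_def)
  then have nz: "A i i \<noteq> 0" for i by simp
  show "lower_unitriangular (smat_inv A)"
    using lower_triangular_smat_inv[OF A(1) nz] smat_inv_diagonal_entry[OF A(1) nz] A(2)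
    by (simp add: lower_unitriangular_def)
  show "A \<odot> smat_inv A = smat_one" "smat_inv A \<odot> A = smat_one"
    using smat_mult_inv[OF A(1) nz] smat_inv_mult[OF A(1) nz] by auto
qed

section \<open>Unit Hessenberg matrices\<close>

text \<open>The shape \<open>\<Lambda>\<close> plus a lower triangular matrix, shared by
  \<open>T\<close> and \<open>Tt\<close>. The diagonals of \<open>Tt \<odot> Tt\<close> are computed
  from this shape alone.\<close>

definition unit_hessenberg :: "smat \<Rightarrow> bool" where
  "unit_hessenberg M \<longleftrightarrow> (\<forall>i j. Suc i < j \<longrightarrow> M i j = 0) \<and> (\<forall>i. M i (Suc i) = 1)"

text \<open>Left multiplication by \<open>\<Lambda>\<close> moves the rows of \<open>B\<close> up by
  one, so its unit diagonal becomes the superdiagonal. The lower unitriangular factor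
  \<open>A\<close> then only adds multiples of higher rows, which end further to the left.\<close>

lemma unit_hessenberg_conj_Lam:
  assumes "lower_unitriangular A" "lower_unitriangular B"
  shows "unit_hessenberg (A \<odot> \<Lambda> \<odot> B)"
proof -
  have A: "lower_triangular A" "\<And>i. A i i = 1" and B: "lower_triangular B" "\<And>i. B i i = 1"
    using assms by (auto simp: lower_unitriangular_def)
  have "A \<odot> \<Lambda> \<odot> B = A \<odot> (\<Lambda> \<odot> B)"
    by (simp add: smat_mult_assoc_row lower_triangular_row_finite A row_finite_Lam)
  then have eq: "(A \<odot> \<Lambda> \<odot> B) i j = (\<Sum>k\<le>i. A i k * B (Suc k) j)" for i j
    by (simp add: lower_triangular_mult_apply A)
  have "(A \<odot> \<Lambda> \<odot> B) i j = 0" if "Suc i < j" for i j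
    unfolding eq using B that by (intro sum.neutral) (auto simp: lower_triangular_def)
  moreover have "(A \<odot> \<Lambda> \<odot> B) i (Suc i) = 1" for i
  proof -
    have "(\<Sum>k\<le>i. A i k * B (Suc k) (Suc i)) = (\<Sum>k\<le>i. if k = i then 1 else 0)"
      using A B by (intro sum.cong) (auto simp: lower_triangular_def)
    then show ?thesis by (simp add: eq)
  qed
  ultimately show ?thesis by (simp add: unit_hessenberg_def)
qed

lemma unit_hessenberg_mult_apply:
  assumes "unit_hessenberg M"
  shows "(M \<odot> B) i j = (\<Sum>k\<le>i. M i k * B k j) + B (Suc i) j"
proof -
  have "(M \<odot> B) i j = (\<Sum>k\<le>Suc i. M i k * B k j)"
    using assms by (intro smat_mult_eq_sum) (auto simp: unit_hessenberg_def)
  then show ?thesis using assms by (simp add: unit_hessenberg_def)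
qed

lemma unit_hessenberg_expansion:
  assumes "unit_hessenberg M"
  shows "M = \<Lambda> + lower_series (\<lambda>k. lower_part k M)"
proof (intro ext)
  fix i j
  have "lower_series (\<lambda>k. lower_part k M) i j
      = Sum_any (\<lambda>k. if i = j + k then M i j else 0)"
    by (simp add: lower_series_def Lam_transpose_pow_mult_diag)
  \<comment> \<open>Above the diagonal the truncated difference is 0, and there the test
    \<open>i = j + k\<close> fails, as it should.\<close>
  also have "\<dots> = (\<Sum>k\<in>{i - j}. if i = j + k then M i j else 0)"
    by (rule Sum_any.expand_superset) auto
  finally have "lower_series (\<lambda>k. lower_part k M) i j = (if j \<le> i then M i j else 0)"
    by simp
  then show "M i j = (\<Lambda> + lower_series (\<lambda>k. lower_part k M)) i j"
    using assms by (auto simp: Lam_def unit_hessenberg_def)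
qed

text \<open>After transposition these upper diagonals give the subdiagonals of \<open>T\<close>: the
  first gives \<open>c\<close>, the second gives \<open>d\<close>, and the zeros beyond make
  \<open>T\<close> tetradiagonal.\<close>

lemma unit_hessenberg_square_upper:
  assumes "unit_hessenberg M"
  shows "(M \<odot> M) n (n + 1) = M n n + M (n + 1) (n + 1)"
    and "(M \<odot> M) n (n + 2) = 1"
    and "n + 2 < j \<Longrightarrow> (M \<odot> M) n j = 0"
proof -
  have M: "M i j = 0" if "Suc i < j" for i j
    using assms that by (simp add: unit_hessenberg_def)
  have M1: "M i (Suc i) = 1" for i
    using assms by (simp add: unit_hessenberg_def)
  note ap = unit_hessenberg_mult_apply[OF assms]
  have "(\<Sum>k\<le>n. M n k * M k (Suc n)) = (\<Sum>k\<le>n. if k = n then M n n else 0)"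
    by (intro sum.cong) (auto simp: M M1)
  then show "(M \<odot> M) n (n + 1) = M n n + M (n + 1) (n + 1)" by (simp add: ap)
  have *: "(\<Sum>k\<le>n. M n k * M k j) = 0" if "n + 1 < j" for j
    using that by (intro sum.neutral) (auto simp: M)
  show "(M \<odot> M) n (n + 2) = 1" using * by (simp add: ap M1)
  show "(M \<odot> M) n j = 0" if "n + 2 < j" using * that by (simp add: ap M)
qed

text \<open>In entry \<open>(m + n, m)\<close> of the square the summation index runs from
  \<open>m - 1\<close> to \<open>m + n + 1\<close>. The two extreme terms each contain a
  superdiagonal 1 and give \<open>lower_part (n + 1) M\<close>, plain from the top index and shifted
  by \<open>a_plus\<close> from the bottom one. The indices from \<open>m\<close> to
  \<open>m + n\<close> give the convolution sum.\<close>

lemma unit_hessenberg_square_lower: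
  assumes "unit_hessenberg M"
  shows "lower_part n (M \<odot> M) = lower_part (n + 1) M + a_plus (lower_part (n + 1) M)
    + (\<Sum>k=0..n. (a_minus ^^ (n - k)) (lower_part k M) \<odot> lower_part (n - k) M)"
proof -
  have M: "M i j = 0" if "Suc i < j" for i j
    using assms that by (simp add: unit_hessenberg_def)
  have M1: "M i (Suc i) = 1" for i
    using assms by (simp add: unit_hessenberg_def)
  have "(M \<odot> M) (m + n) m = M (m + (n + 1)) m
      + (case m of 0 \<Rightarrow> 0 | Suc l \<Rightarrow> M (Suc (l + n)) l)
      + (\<Sum>k=0..n. M (m + (n - k) + k) (m + (n - k)) * M (m + (n - k)) m)" for m
  proof -
    have "(\<Sum>k\<le>m + n. M (m + n) k * M k m)
        = (\<Sum>k<m. M (m + n) k * M k m) + (\<Sum>k=m..m + n. M (m + n) k * M k m)"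
      by (subst sum.union_disjoint[symmetric]) (auto intro!: sum.cong)
    \<comment> \<open>Only \<open>k = m - 1\<close> survives; for \<open>m = 0\<close> the range is
      empty, which matches the leading 0 of \<open>a_plus\<close>.\<close>
    also have "(\<Sum>k<m. M (m + n) k * M k m) = (case m of 0 \<Rightarrow> 0 | Suc l \<Rightarrow> M (Suc (l + n)) l)"
      by (cases m) (auto simp: M M1 intro!: sum.neutral)
    \<comment> \<open>The range is read downwards. The row index \<open>m + n\<close> is written as
      \<open>m + (n - k) + k\<close> to exhibit the \<open>k\<close>-th subdiagonal shifted by
      \<open>n - k\<close>.\<close>
    also have "(\<Sum>k=m..m + n. M (m + n) k * M k m)
        = (\<Sum>k=0..n. M (m + (n - k) + k) (m + (n - k)) * M (m + (n - k)) m)"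
      by (rule sum.reindex_bij_witness[of _ "\<lambda>k. m + (n - k)" "\<lambda>k. m + n - k"]) auto
    finally show ?thesis
      by (simp add: unit_hessenberg_mult_apply[OF assms])
  qed
  then show ?thesis by (simp add: lower_part_def sum_diag)
qed

section \<open>The recursion matrices\<close>

text \<open>The integrands agree pointwise: a factor \<open>x\<close> moves from
  \<open>X_vec\<close> to \<open>X1_vec\<close> and \<open>X2_vec\<close>, where it raises the index
  by two, since this keeps the parity and increases \<open>n div 2\<close> by one.\<close>

lemma moment_matrix_shift:
  "\<Lambda> \<odot> moment_matrix \<Delta> \<mu> w1 w2
    = moment_matrix \<Delta> \<mu> w1 w2 \<odot> (smat_transpose \<Lambda> \<odot> smat_transpose \<Lambda>)"
proof -
  have "X_vec x (Suc i) * (X1_vec x j * w1 x + X2_vec x j * w2 x)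
      = X_vec x i * (X1_vec x (Suc (Suc j)) * w1 x + X2_vec x (Suc (Suc j)) * w2 x)" for x i j
    by (simp add: X_vec_def X1_vec_def X2_vec_def)
  then have "\<Lambda> \<odot> moment_matrix \<Delta> \<mu> w1 w2
      = (moment_matrix \<Delta> \<mu> w1 w2 \<odot> smat_transpose \<Lambda>) \<odot> smat_transpose \<Lambda>"
    by (intro ext) (simp add: moment_matrix_def)
  then show ?thesis by (simp add: smat_mult_assoc_col col_finite_Lam_transpose)
qed

lemma recursion_matrix_relation:
  assumes gb: "gauss_borel g S H St"
    and shift: "\<Lambda> \<odot> g = g \<odot> (smat_transpose \<Lambda> \<odot> smat_transpose \<Lambda>)"
    and T: "T = S \<odot> \<Lambda> \<odot> smat_inv S" and Tt: "Tt = St \<odot> \<Lambda> \<odot> smat_inv St"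
  shows "T \<odot> H = H \<odot> smat_transpose (Tt \<odot> Tt)"
proof -
  define Si Sti where "Si = smat_inv S" and "Sti = smat_inv St"
  define P where "P = smat_transpose \<Lambda> \<odot> smat_transpose \<Lambda>"
  have S: "lower_unitriangular S" "lower_unitriangular St" and "diagonal H"
    and g: "g = Si \<odot> H \<odot> smat_transpose Sti"
    using gb by (auto simp: gauss_borel_def Si_def Sti_def)
  note inv = lower_unitriangular_inv[OF S(1), folded Si_def]
    lower_unitriangular_inv[OF S(2), folded Sti_def]
  obtain h where "H = diag h"
    using diagonal_eq_diag[OF \<open>diagonal H\<close>] by blast
  then have "row_finite H" "col_finite H"
    by (simp_all add: row_finite_diag col_finite_diag)
  moreover have "row_finite S" "row_finite St" "row_finite Si" "row_finite Sti"
    using S inv by (auto simp: lower_unitriangular_def lower_triangular_row_finite)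
  ultimately have fin: "row_finite H" "col_finite H" "row_finite S" "row_finite St"
      "row_finite Si" "row_finite Sti"
    and col: "col_finite (smat_transpose St)" "col_finite (smat_transpose Sti)"
    by (auto simp: col_finite_def)
  have colP: "col_finite P"
    by (simp add: P_def col_finite_mult col_finite_Lam_transpose)
  let ?U = "H \<odot> smat_transpose Sti"
  have gU: "g = Si \<odot> ?U"
    by (simp add: g smat_mult_assoc_row fin)
  have SgU: "S \<odot> g = ?U"
    unfolding gU using smat_mult_assoc_row[of S Si ?U] fin inv(2) by simp
  have "T \<odot> ?U = S \<odot> (\<Lambda> \<odot> g)"
    by (simp add: T gU smat_mult_assoc_row row_finite_mult fin row_finite_Lam flip: Si_def)
  \<comment> \<open>By the shift relation the left side is \<open>S \<odot> (g \<odot> P)\<close>.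
    It may be regrouped as \<open>(S \<odot> g) \<odot> P\<close> because \<open>S\<close> is row
    finite and \<open>P\<close> column finite.\<close>
  also have "\<dots> = ?U \<odot> P"
    using smat_mult_assoc_row_col[of S P g] fin colP
    by (simp add: shift SgU flip: P_def)
  \<comment> \<open>The factor on the right cancels the transpose of \<open>Sti\<close> inside
    \<open>?U\<close> on the left side, and on the right side completes the transposed square of
    \<open>Tt\<close>.\<close>
  finally have TU: "T \<odot> ?U \<odot> smat_transpose St = ?U \<odot> P \<odot> smat_transpose St" by simp
  have unit: "smat_transpose Sti \<odot> smat_transpose St = smat_one"
    by (metis inv(5) transpose_mult transpose_one)
  have "T \<odot> ?U \<odot> smat_transpose St = T \<odot> H"
    by (simp add: smat_mult_assoc_col col_finite_mult fin col unit)
  moreover have "?U \<odot> P \<odot> smat_transpose St = H \<odot> smat_transpose (Tt \<odot> Tt)"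
  proof -
    have "Tt \<odot> Tt = St \<odot> (\<Lambda> \<odot> ((Sti \<odot> St) \<odot> (\<Lambda> \<odot> Sti)))"
      by (simp add: Tt smat_mult_assoc_row row_finite_mult fin row_finite_Lam flip: Sti_def)
    also have "\<dots> = St \<odot> (smat_transpose P \<odot> Sti)"
      by (simp add: inv P_def transpose_mult smat_mult_assoc_row row_finite_Lam)
    finally have "smat_transpose (Tt \<odot> Tt) = smat_transpose Sti \<odot> P \<odot> smat_transpose St"
      by (simp add: transpose_mult)
    then show ?thesis
      by (simp add: smat_mult_assoc_col col_finite_mult fin col colP)
  qed
  ultimately show ?thesis using TU by simp
qed

theorem theorem2:
  fixes \<Delta> :: "real set" and \<mu> :: "real measure" and w1 w2 :: "real \<Rightarrow> real"
    and S St H T Tt That b c d :: smat and Td :: "nat \<Rightarrow> smat"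
  assumes "weight_system \<Delta> \<mu> w1 w2"
    and "gauss_borel (moment_matrix \<Delta> \<mu> w1 w2) S H St"
    and "T = S \<odot> \<Lambda> \<odot> smat_inv S"
    and "Tt = St \<odot> \<Lambda> \<odot> smat_inv St"
    and "That = smat_inv H \<odot> Tt \<odot> H"
    and "b = lower_part 0 T" and "c = lower_part 1 T" and "d = lower_part 2 T"
    and "\<And>k. Td k = lower_part k Tt"
  shows "T = \<Lambda> + b + smat_transpose \<Lambda> \<odot> c + smat_pow (smat_transpose \<Lambda>) 2 \<odot> d \<and>
    Tt = \<Lambda> + lower_series Td \<and>
    smat_transpose T = smat_pow That 2 \<and>
    d = (a_minus ^^ 2) H \<odot> smat_inv H \<and>
    c = a_minus H \<odot> smat_inv H \<odot> (a_minus (Td 0) + Td 0) \<and>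
    b = Td 1 + a_plus (Td 1) + smat_pow (Td 0) 2 \<and>
    a_minus H \<odot> smat_inv H
      = Td 2 + a_plus (Td 2) + (a_minus (Td 0) + Td 0) \<odot> Td 1 \<and>
    (\<forall>n\<ge>2. Td (n + 1) + a_plus (Td (n + 1))
      + (\<Sum>k=0..n. (a_minus ^^ (n - k)) (Td k) \<odot> Td (n - k)) = 0)"
proof -
  define h where "h = (\<lambda>n. H n n)"
  note gb = assms(2)
  have H: "H = diag h" and h: "h n \<noteq> 0" for n
    using gb by (auto simp: gauss_borel_def h_def intro: diagonal_eq_diag)
  have Hinv: "smat_inv H = diag (\<lambda>n. 1 / h n)"
    using h by (simp add: H smat_inv_diag)
  have S: "lower_unitriangular S" "lower_unitriangular St"
    using gb by (auto simp: gauss_borel_def)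
  have uT: "unit_hessenberg T" and uTt: "unit_hessenberg Tt"
    using S by (simp_all add: assms(3,4) unit_hessenberg_conj_Lam lower_unitriangular_inv(1))
  have Td: "Td = (\<lambda>k. lower_part k Tt)"
    using assms(9) by blast
  \<comment> \<open>All formulas are read off from this entrywise relation: for
    \<open>i \<ge> j\<close> it determines \<open>d\<close>, \<open>c\<close> and \<open>b\<close>,
    and for \<open>i < j\<close>, where \<open>T\<close> is known, it constrains
    \<open>Tt\<close>.\<close>
  have TTt: "T i j = h i * (Tt \<odot> Tt) j i / h j" for i j
  proof -
    have "(T \<odot> H) i j = (H \<odot> smat_transpose (Tt \<odot> Tt)) i j"
      using recursion_matrix_relation[OF gb moment_matrix_shift assms(3,4)] by simp
    then have "T i j * h j = h i * (Tt \<odot> Tt) j i"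
      by (simp add: H smat_transpose_def)
    then show ?thesis using h[of j] by (simp add: field_simps)
  qed
  have sq: "lower_part n (Tt \<odot> Tt) = Td (n + 1) + a_plus (Td (n + 1))
      + (\<Sum>k=0..n. (a_minus ^^ (n - k)) (Td k) \<odot> Td (n - k))" for n
    unfolding Td by (rule unit_hessenberg_square_lower[OF uTt])
  note sq_upper = unit_hessenberg_square_upper[OF uTt]

  have "T i j = (\<Lambda> + b + smat_transpose \<Lambda> \<odot> c + smat_pow (smat_transpose \<Lambda>) 2 \<odot> d) i j" for i j
  proof -
    have "(smat_transpose \<Lambda> \<odot> c) i j = (if i = j + 1 then T i j else 0)"
      using Lam_transpose_pow_mult_diag[of 1 T i j] by (simp add: assms(7))
    moreover have "b i j = (if i = j then T i j else 0)"
      by (simp add: assms(6) lower_part_def diag_def)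
    moreover have "T i j = 0" if "j + 2 < i"
      using sq_upper(3)[OF that] by (simp add: TTt)
    moreover have "j < i \<Longrightarrow> i = j + 1 \<or> i = j + 2 \<or> j + 2 < i" by arith
    ultimately show ?thesis
      using uT unfolding assms(8) plus_fun_apply Lam_transpose_pow_mult_diag
      by (cases i j rule: linorder_cases) (auto simp: Lam_def unit_hessenberg_def)
  qed
  then have 1: "T = \<Lambda> + b + smat_transpose \<Lambda> \<odot> c + smat_pow (smat_transpose \<Lambda>) 2 \<odot> d"
    by blast
  have 2: "Tt = \<Lambda> + lower_series Td"
    unfolding Td by (rule unit_hessenberg_expansion[OF uTt])
  have That: "That i j = Tt i j * h j / h i" for i j
    unfolding assms(5) Hinv unfolding H by simp
  have "smat_pow That 2 i j = smat_transpose T i j" for i j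
  proof -
    \<comment> \<open>Conjugation by \<open>H\<close> keeps the support of the rows, and the
      intermediate factors \<open>h k\<close> cancel in each product.\<close>
    have "(That \<odot> That) i j = (\<Sum>k\<le>Suc i. That i k * That k j)"
      using uTt by (intro smat_mult_eq_sum) (auto simp: unit_hessenberg_def That)
    also have "\<dots> = (\<Sum>k\<le>Suc i. Tt i k * Tt k j) * h j / h i"
      unfolding sum_distrib_right sum_divide_distrib
      using h by (intro sum.cong) (auto simp: That field_simps)
    also have "(\<Sum>k\<le>Suc i. Tt i k * Tt k j) = (Tt \<odot> Tt) i j"
      using uTt by (intro smat_mult_eq_sum[symmetric]) (auto simp: unit_hessenberg_def)
    finally show ?thesis by (simp add: smat_transpose_def TTt)
  qed
  then have 3: "smat_transpose T = smat_pow That 2" by (intro ext) simp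
  \<comment> \<open>The entry of \<open>T\<close> at \<open>(n + 2, n)\<close> is
    \<open>h (n + 2) / h n\<close>, with the row index on top, so the quotient is this one and not
    its reciprocal. The same holds for the factor of \<open>c\<close>.\<close>
  have 4: "d = (a_minus ^^ 2) H \<odot> smat_inv H"
    unfolding Hinv unfolding H using sq_upper(2) by (simp add: assms(8) lower_part_def TTt)
  have 5: "c = a_minus H \<odot> smat_inv H \<odot> (a_minus (Td 0) + Td 0)"
    unfolding Hinv unfolding H using sq_upper(1)
    by (simp add: assms(7) lower_part_def TTt Td add.commute)
  have "b = lower_part 0 (Tt \<odot> Tt)"
    using h by (simp add: assms(6) lower_part_def TTt)
  then have 6: "b = Td 1 + a_plus (Td 1) + smat_pow (Td 0) 2"
    by (simp add: sq)
  \<comment> \<open>This is the relation on the superdiagonal of \<open>T\<close>, whose entries are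
    1.\<close>
  have "(Tt \<odot> Tt) (Suc n) n = h (Suc n) / h n" for n
    using TTt[of n "Suc n"] uT h[of n] h[of "Suc n"]
    by (simp add: unit_hessenberg_def field_simps)
  then have "a_minus H \<odot> smat_inv H = lower_part 1 (Tt \<odot> Tt)"
    unfolding Hinv unfolding H by (simp add: lower_part_def)
  also have "\<dots> = Td 2 + a_plus (Td 2) + (a_minus (Td 0) + Td 0) \<odot> Td 1"
    unfolding sq by (simp add: Td lower_part_def numeral_2_eq_2 algebra_simps)
  finally have 7: "a_minus H \<odot> smat_inv H
      = Td 2 + a_plus (Td 2) + (a_minus (Td 0) + Td 0) \<odot> Td 1" .
  \<comment> \<open>These subdiagonals correspond to the entries of \<open>T\<close> above its
    superdiagonal, which vanish.\<close>
  have "lower_part n (Tt \<odot> Tt) = 0" if "n \<ge> 2" for n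
  proof -
    have "(Tt \<odot> Tt) (m + n) m = 0" for m
      using TTt[of m "m + n"] uT h[of m] h[of "m + n"] that by (simp add: unit_hessenberg_def)
    then show ?thesis by (auto simp: lower_part_def diag_def fun_eq_iff)
  qed
  then have 8: "\<forall>n\<ge>2. Td (n + 1) + a_plus (Td (n + 1))
      + (\<Sum>k=0..n. (a_minus ^^ (n - k)) (Td k) \<odot> Td (n - k)) = 0"
    using sq by metis
  show ?thesis using 1 2 3 4 5 6 7 8 by blast
qed

end
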